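(* Assume that $k=k(n)$ satisfies $n\ll k(n)$, i.e. $n=o(k(n))$ as $n\to\infty$. Then, as $n\to\infty$, $$\frac{N_{k(n)}}{n}\to1\quad\text{and}\quad\frac{L_{k(n)}}{n}\to1\qquad\text{in probability},$$ where $N_{k(n)}$ and $L_{k(n)}$ are, respectively, the number of non-empty buses and the number of lonely passengers in the $n$-detachment process at time $k(n)$.
   Context: The $n$-detachment process ($n\ge1$): there are $n$ labeled passengers. At time $1$ all passengers sit in bus number $1$. At each integer time $k\ge 2$, a new bus with number $k$ becomes available and each passenger (currently sitting in one of the buses $1,\dots,k-1$), independently of the others and of the past, relocates to bus $k$ with probability $1/k$ and otherwise stays where they are. The process is extended to real times $t\ge 1$ by letting its state at time $t$ be its state at time $\lfloor t\rfloor$. A passenger is lonely at time $k$ if no other passenger is in the same bus at time $k$. *)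

theory Defs
  imports "HOL-Probability.Probability" "HOL-Library.Landau_Symbols"
begin

text \<open>
  The passengers are labelled by the elements of \<open>{1..n}\<close>, and \<open>X k i \<omega>\<close> is the bus in which passenger
  \<open>i\<close> sits at the integer time \<open>k \<ge> 1\<close>. The locale does not construct the process; it says that a
  given family \<open>X\<close> on a given probability space is an \<open>n\<close>-detachment process.

  Bus \<open>k\<close> is new at time \<open>k\<close>, so a passenger is in bus \<open>k\<close> at time \<open>k\<close> precisely when he relocates at
  that time. Up to null sets the state at time \<open>k\<close> is a function of the relocation events up to time
  \<open>k\<close>, and hence mutual independence of all relocation events over passengers and times says that
  each relocation is independent of the other passengers and of the past.
\<close>

definition relocation :: "'a measure \<Rightarrow> (nat \<Rightarrow> nat \<Rightarrow> 'a \<Rightarrow> nat) \<Rightarrow> nat \<Rightarrow> nat \<Rightarrow> 'a set"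
  where "relocation M X k i = {\<omega> \<in> space M. X k i \<omega> = k}"

locale detachment_process = prob_space M
  for M :: "'a measure" and n :: nat and X :: "nat \<Rightarrow> nat \<Rightarrow> 'a \<Rightarrow> nat" +
  assumes passengers: "n \<ge> 1"
    and random_bus: "\<And>k i. k \<ge> 1 \<Longrightarrow> i \<in> {1..n} \<Longrightarrow> random_variable (count_space UNIV) (X k i)"
    and start: "\<And>i. i \<in> {1..n} \<Longrightarrow> AE \<omega> in M. X 1 i \<omega> = 1"
    and relocate_or_stay:
      "\<And>k i. k \<ge> 2 \<Longrightarrow> i \<in> {1..n} \<Longrightarrow> AE \<omega> in M. X k i \<omega> = k \<or> X k i \<omega> = X (k - 1) i \<omega>"
    and relocation_prob:
      "\<And>k i. k \<ge> 2 \<Longrightarrow> i \<in> {1..n} \<Longrightarrow> prob (relocation M X k i) = 1 / real k"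
    and relocation_indep:
      "indep_events (\<lambda>(k, i). relocation M X k i) ({2..} \<times> {1..n})"

definition real_time :: "(nat \<Rightarrow> nat \<Rightarrow> 'a \<Rightarrow> nat) \<Rightarrow> real \<Rightarrow> nat \<Rightarrow> 'a \<Rightarrow> nat"
  where "real_time X t = X (nat \<lfloor>t\<rfloor>)"

definition nonempty_buses :: "nat \<Rightarrow> (nat \<Rightarrow> nat \<Rightarrow> 'a \<Rightarrow> nat) \<Rightarrow> real \<Rightarrow> 'a \<Rightarrow> nat"
  where "nonempty_buses n X t \<omega> = card {b. \<exists>i\<in>{1..n}. real_time X t i \<omega> = b}"

definition lonely_passengers :: "nat \<Rightarrow> (nat \<Rightarrow> nat \<Rightarrow> 'a \<Rightarrow> nat) \<Rightarrow> real \<Rightarrow> 'a \<Rightarrow> nat"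
  where "lonely_passengers n X t \<omega> =
    card {i \<in> {1..n}. \<forall>j\<in>{1..n}. j \<noteq> i \<longrightarrow> real_time X t j \<omega> \<noteq> real_time X t i \<omega>}"

text \<open>
  Convergence in probability to a constant; the \<open>n\<close>-th variable lives on its own probability space
  \<open>M n\<close>. Measurability is part of the definition because \<open>measure\<close> is \<open>0\<close> on non-measurable sets.
\<close>

definition converges_in_probability ::
    "(nat \<Rightarrow> 'a measure) \<Rightarrow> (nat \<Rightarrow> 'a \<Rightarrow> real) \<Rightarrow> real \<Rightarrow> bool"
  where "converges_in_probability M Y c \<longleftrightarrow>
    (\<forall>\<^sub>F n in sequentially. Y n \<in> borel_measurable (M n)) \<and>
    (\<forall>\<epsilon>>0. (\<lambda>n. measure (M n) {\<omega> \<in> space (M n). \<bar>Y n \<omega> - c\<bar> > \<epsilon>}) \<longlonglongrightarrow> 0)"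

end

theory Submission
  imports Defs
begin

text \<open>
  The bus of a passenger at time \<open>m\<close> is the number of his last relocation time, which is uniform on
  \<open>{1..m}\<close>, since \<open>1/b \<cdot> (1 - 1/(b+1)) \<cdots> (1 - 1/m) = 1/m\<close>. Hence two given passengers share a bus at
  time \<open>m\<close> with probability \<open>1/m\<close>, and the expected number of ordered pairs sharing a bus is at most
  \<open>n\<^sup>2/m = o(n)\<close>. As \<open>n\<close> minus this number is at most \<open>L\<close>, and \<open>L \<le> N \<le> n\<close>, Markov's inequality
  gives both limits.
\<close>

section \<open>Paths of a single passenger and the telescoping product\<close>

text \<open>A path of one passenger either jumps at time \<open>Suc m\<close>, which leaves no later
  time to check, or keeps \<open>x m\<close>, which is at most \<open>m\<close>, so that
  \<open>Suc m\<close> is not a relocation time. Thus the bus number records the last relocation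
  time, with time 1 counted as a relocation.\<close>

lemma last_relocation:
  fixes x :: "nat \<Rightarrow> nat"
  assumes "x 1 = 1" and step: "\<And>k. k \<ge> 2 \<Longrightarrow> x k = k \<or> x k = x (k - 1)" and "m \<ge> 1"
  shows "x m \<in> {1..m} \<and> x (x m) = x m \<and> (\<forall>l\<in>{x m<..m}. x l \<noteq> l)"
  using \<open>m \<ge> 1\<close>
proof (induction m rule: dec_induct)
  case base
  then show ?case using assms(1) by auto
next
  case (step m)
  have "x (Suc m) = Suc m \<or> x (Suc m) = x m"
    using assms(2)[of "Suc m"] step.hyps by simp
  then show ?case
  proof
    assume "x (Suc m) = Suc m"
    then show ?thesis by simp
  next
    assume "x (Suc m) = x m"
    then show ?thesis using step.IH by (auto simp: le_Suc_eq)
  qed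
qed

text \<open>Times before \<open>b\<close> are unconstrained, and the factors (l - 1)/l after
  \<open>b\<close> telescope to b/m. The factor 1/b at \<open>l = b\<close> cancels the numerator;
  for \<open>b = 1\<close> it is absent, as the range starts at 2, but then the numerator is 1
  already.\<close>

lemma prod_last_relocation:
  fixes b m :: nat
  assumes "1 \<le> b" "b \<le> m"
  shows "(\<Prod>l=2..m. if l < b then 1 else if l = b then 1 / real l else 1 - 1 / real l) = 1 / real m"
proof -
  have "1 \<le> m" using assms by simp
  then show ?thesis using \<open>b \<le> m\<close>
  proof (induction m rule: dec_induct)
    case base
    then show ?case by simp
  next
    case (step m)
    show ?case
    proof (cases "b = Suc m")
      case True
      have "(\<Prod>l=2..m. if l < b then 1 else if l = b then 1 / real l else 1 - 1 / real l) = 1"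
        using True by (intro prod.neutral) auto
      then show ?thesis using True step.hyps by (simp add: prod.nat_ivl_Suc')
    next
      case False
      then have "b \<le> m" using step.prems by simp
      then show ?thesis using step.IH step.hyps
        by (simp add: prod.nat_ivl_Suc' field_simps)
    qed
  qed
qed

section \<open>The probability that two passengers share a bus\<close>

context detachment_process
begin

lemma relocation_events: "k \<ge> 1 \<Longrightarrow> i \<in> {1..n} \<Longrightarrow> relocation M X k i \<in> events"
  using random_bus[of k i] unfolding relocation_def by measurable

text \<open>The intersection says that \<open>i\<close> and \<open>j\<close> both relocated for the
  last time at \<open>b\<close> (never, if \<open>b = 1\<close>). Putting \<open>space M\<close> at
  the times before \<open>b\<close> gives one index set for all \<open>b\<close>. By independence
  each of the two passengers contributes a factor 1/m.\<close>

lemma prob_last_relocation: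
  fixes b m :: nat
  defines "A \<equiv> \<lambda>(l, p). if l < b then space M else if l = b then relocation M X l p
    else space M - relocation M X l p"
  assumes m: "m \<ge> 2" and b: "b \<in> {1..m}" and ij: "i \<in> {1..n}" "j \<in> {1..n}" "i \<noteq> j"
  shows "prob (\<Inter>q\<in>{2..m} \<times> {i, j}. A q) = 1 / (real m)\<^sup>2"
proof -
  let ?R = "\<lambda>(k, i). relocation M X k i"
  let ?J = "{2..m} \<times> {i, j}"
  let ?f = "\<lambda>l. if l < b then 1 else if l = b then 1 / real l else 1 - 1 / real l"
  have "indep_sets (\<lambda>q. {?R q}) ({2..} \<times> {1..n})"
    using relocation_indep unfolding indep_events_def_alt .
  \<comment> \<open>Complements and the whole space also occur among the \<open>A q\<close>, so
    independence is lifted from the relocation events to the sigma-algebras they generate.\<close>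
  then have indep: "indep_sets (\<lambda>q. sigma_sets (space M) {?R q}) ({2..} \<times> {1..n})"
    by (rule indep_sets_sigma) (auto simp: Int_stable_def)
  have "prob (\<Inter>q\<in>?J. A q) = (\<Prod>q\<in>?J. prob (A q))"
  proof (rule indep_setsD[OF indep])
    show "\<forall>q\<in>?J. A q \<in> sigma_sets (space M) {?R q}"
      by (auto simp: A_def sigma_sets_top intro: sigma_sets.Compl)
  qed (use m ij in auto)
  also have "\<dots> = (\<Prod>q\<in>?J. ?f (fst q))"
  proof (rule prod.cong[OF refl])
    fix q assume "q \<in> ?J"
    then obtain l p where q: "q = (l, p)" "2 \<le> l" "p \<in> {1..n}" using ij by auto
    then show "prob (A q) = ?f (fst q)"
      using relocation_prob[of l p] relocation_events[of l p]
      by (auto simp: A_def prob_space prob_compl)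
  qed
  also have "\<dots> = (\<Prod>l=2..m. \<Prod>p\<in>{i, j}. ?f l)"
    by (subst prod.cartesian_product) (simp add: case_prod_beta)
  also have "\<dots> = (\<Prod>l=2..m. ?f l)\<^sup>2"
    using ij(3) by (simp add: power2_eq_square prod.distrib)
  also have "\<dots> = 1 / (real m)\<^sup>2"
    using prod_last_relocation[of b m] b by (simp add: power_divide)
  finally show ?thesis .
qed

text \<open>The step condition holds almost surely for each time; countably many null sets combine
  into one, outside which the pathwise lemma applies.\<close>

lemma AE_last_relocation:
  assumes "i \<in> {1..n}" "m \<ge> 1"
  shows "AE \<omega> in M. X m i \<omega> \<in> {1..m} \<and> X (X m i \<omega>) i \<omega> = X m i \<omega>
    \<and> (\<forall>l\<in>{X m i \<omega><..m}. X l i \<omega> \<noteq> l)"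
proof -
  have "AE \<omega> in M. \<forall>k. k \<ge> 2 \<longrightarrow> X k i \<omega> = k \<or> X k i \<omega> = X (k - 1) i \<omega>"
    using relocate_or_stay[OF _ assms(1)] by (subst AE_all_countable) auto
  with start[OF assms(1)] show ?thesis
  proof eventually_elim
    case (elim \<omega>)
    show ?case
      by (rule last_relocation[of "\<lambda>k. X k i \<omega>"]) (use elim assms in auto)
  qed
qed

lemma same_bus_events:
  assumes "i \<in> {1..n}" "j \<in> {1..n}" "m \<ge> 1"
  shows "{\<omega> \<in> space M. X m i \<omega> = X m j \<omega>} \<in> events"
proof -
  note [measurable] = random_bus[OF assms(3,1)] random_bus[OF assms(3,2)]
  \<comment> \<open>Naming the common bus turns the event into a countable union of measurable
    sets.\<close>
  have "{\<omega> \<in> space M. X m i \<omega> = X m j \<omega>} = {\<omega> \<in> space M. \<exists>b. X m i \<omega> = b \<and> X m j \<omega> = b}"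
    by auto
  also have "\<dots> \<in> events" by measurable
  finally show ?thesis .
qed

lemma prob_same_bus:
  assumes ij: "i \<in> {1..n}" "j \<in> {1..n}" "i \<noteq> j" and m: "m \<ge> 1"
  shows "prob {\<omega> \<in> space M. X m i \<omega> = X m j \<omega>} \<le> 1 / real m"
proof (cases "m = 1")
  case True
  then show ?thesis by simp
next
  case False
  then have m2: "m \<ge> 2" using m by simp
  define A where "A b = (\<lambda>(l, p). if l < b then space M else if l = b then relocation M X l p
    else space M - relocation M X l p)" for b
  define E where "E b = (\<Inter>q\<in>{2..m} \<times> {i, j}. A b q)" for b
  have A: "A b q \<in> events" if "q \<in> {2..m} \<times> {i, j}" for b q
    using that ij relocation_events by (auto simp: A_def)
  have E: "E b \<in> events" for b
    unfolding E_def using A m2 by (intro sets.finite_INT) auto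
  \<comment> \<open>Almost surely a common bus \<open>b\<close> is the last relocation time of both
    passengers, which is what \<open>E b\<close> describes. The union bound then adds up
    \<open>m\<close> terms 1/m^2.\<close>
  have "AE \<omega> in M. \<omega> \<in> {\<omega> \<in> space M. X m i \<omega> = X m j \<omega>} \<longrightarrow> \<omega> \<in> (\<Union>b\<in>{1..m}. E b)"
    using AE_last_relocation[OF ij(1) m] AE_last_relocation[OF ij(2) m] AE_space
  proof eventually_elim
    case (elim \<omega>)
    show ?case
    proof
      assume "\<omega> \<in> {\<omega> \<in> space M. X m i \<omega> = X m j \<omega>}"
      then have "X m i \<omega> = X m j \<omega>" by simp
      with elim have "\<omega> \<in> E (X m i \<omega>)"
        by (auto simp: E_def A_def relocation_def)
      then show "\<omega> \<in> (\<Union>b\<in>{1..m}. E b)" using elim by blast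
    qed
  qed
  then have "prob {\<omega> \<in> space M. X m i \<omega> = X m j \<omega>} \<le> prob (\<Union>b\<in>{1..m}. E b)"
    using E by (intro finite_measure_mono_AE) auto
  also have "\<dots> \<le> (\<Sum>b\<in>{1..m}. prob (E b))"
    using E by (intro finite_measure_subadditive_finite) auto
  also have "\<dots> = (\<Sum>b\<in>{1..m}. 1 / (real m)\<^sup>2)"
    using prob_last_relocation[OF m2 _ ij] by (intro sum.cong) (auto simp: E_def A_def)
  also have "\<dots> = 1 / real m" by (simp add: power2_eq_square)
  finally show ?thesis .
qed

section \<open>The expected number of ordered pairs sharing a bus\<close>

definition shared_pairs :: "nat \<Rightarrow> 'a \<Rightarrow> real"
  where "shared_pairs m \<omega> = (\<Sum>i\<in>{1..n}. \<Sum>j\<in>{1..n} - {i}.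
    indicator {\<omega> \<in> space M. X m i \<omega> = X m j \<omega>} \<omega>)"

lemma shared_pairs_nonneg: "0 \<le> shared_pairs m \<omega>"
  by (simp add: shared_pairs_def sum_nonneg)

lemma integrable_shared_pairs: "m \<ge> 1 \<Longrightarrow> integrable M (shared_pairs m)"
  unfolding shared_pairs_def[abs_def]
  using same_bus_events by (intro Bochner_Integration.integrable_sum) (auto simp: less_top[symmetric])

text \<open>Linearity of expectation: there are n(n - 1) ordered pairs, each contributing at most
  1/m.\<close>

lemma expectation_shared_pairs:
  assumes m: "m \<ge> 1"
  shows "expectation (shared_pairs m) \<le> (real n)\<^sup>2 / real m"
proof -
  have "expectation (shared_pairs m)
      = (\<Sum>i\<in>{1..n}. \<Sum>j\<in>{1..n} - {i}. prob {\<omega> \<in> space M. X m i \<omega> = X m j \<omega>})"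
    unfolding shared_pairs_def[abs_def]
  proof (subst Bochner_Integration.integral_sum)
    fix i assume i: "i \<in> {1..n}"
    show "integrable M (\<lambda>\<omega>. \<Sum>j\<in>{1..n} - {i}. indicat_real {\<omega> \<in> space M. X m i \<omega> = X m j \<omega>} \<omega>)"
      using same_bus_events i m
      by (intro Bochner_Integration.integrable_sum) (auto simp: less_top[symmetric])
  next
    show "(\<Sum>i\<in>{1..n}. expectation (\<lambda>\<omega>. \<Sum>j\<in>{1..n} - {i}.
        indicat_real {\<omega> \<in> space M. X m i \<omega> = X m j \<omega>} \<omega>))
      = (\<Sum>i\<in>{1..n}. \<Sum>j\<in>{1..n} - {i}. prob {\<omega> \<in> space M. X m i \<omega> = X m j \<omega>})"
    proof (rule sum.cong[OF refl])
      fix i assume i: "i \<in> {1..n}"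
      show "expectation (\<lambda>\<omega>. \<Sum>j\<in>{1..n} - {i}. indicat_real {\<omega> \<in> space M. X m i \<omega> = X m j \<omega>} \<omega>)
        = (\<Sum>j\<in>{1..n} - {i}. prob {\<omega> \<in> space M. X m i \<omega> = X m j \<omega>})"
        using same_bus_events[OF i _ m]
        by (subst Bochner_Integration.integral_sum) (auto simp: less_top[symmetric] Int_absorb2 intro!: sum.cong)
    qed
  qed
  also have "\<dots> \<le> (\<Sum>i\<in>{1..n}. \<Sum>j\<in>{1..n} - {i}. 1 / real m)"
    using prob_same_bus m by (intro sum_mono) auto
  also have "\<dots> = real n * real (n - 1) / real m"
    by (simp add: card_Diff_singleton del: of_nat_diff)
  also have "\<dots> \<le> (real n)\<^sup>2 / real m"
    by (intro divide_right_mono) (auto simp: power2_eq_square intro!: mult_left_mono)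
  finally show ?thesis .
qed

section \<open>Pathwise bounds for the two counts\<close>

text \<open>Since pairs are ordered, every passenger has an inner sum of his own in
  \<open>shared_pairs\<close>, and it is at least 1 unless he is lonely.\<close>

lemma lonely_lower_bound:
  assumes "\<omega> \<in> space M"
  shows "real n - shared_pairs (nat \<lfloor>t\<rfloor>) \<omega> \<le> real (lonely_passengers n X t \<omega>)"
proof -
  let ?x = "\<lambda>i. X (nat \<lfloor>t\<rfloor>) i \<omega>"
  let ?L = "{i \<in> {1..n}. \<forall>j\<in>{1..n}. j \<noteq> i \<longrightarrow> ?x j \<noteq> ?x i}"
  have "real n = (\<Sum>i\<in>{1..n}. 1)" by simp
  also have "\<dots> \<le> (\<Sum>i\<in>{1..n}. indicator ?L i + (\<Sum>j\<in>{1..n} - {i}.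
      indicator {\<omega> \<in> space M. X (nat \<lfloor>t\<rfloor>) i \<omega> = X (nat \<lfloor>t\<rfloor>) j \<omega>} \<omega>))"
  proof (rule sum_mono)
    fix i assume i: "i \<in> {1..n}"
    let ?s = "\<lambda>j. indicator {\<omega> \<in> space M. X (nat \<lfloor>t\<rfloor>) i \<omega> = X (nat \<lfloor>t\<rfloor>) j \<omega>} \<omega> :: real"
    show "1 \<le> indicator ?L i + (\<Sum>j\<in>{1..n} - {i}. ?s j)"
    proof (cases "i \<in> ?L")
      case True
      then show ?thesis by (simp add: sum_nonneg)
    next
      case False
      then obtain j where j: "j \<in> {1..n} - {i}" "?x i = ?x j" using i by auto
      \<comment> \<open>The indicated set lies inside \<open>space M\<close>, so the indicator is 1
        only because \<open>\<omega>\<close> is a point of the space.\<close>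
      then have "1 = ?s j" using assms by simp
      also have "\<dots> \<le> (\<Sum>j\<in>{1..n} - {i}. ?s j)"
        using j by (intro member_le_sum) auto
      finally show ?thesis by (simp add: indicator_def)
    qed
  qed
  also have "\<dots> = (\<Sum>i\<in>{1..n}. indicator ?L i) + shared_pairs (nat \<lfloor>t\<rfloor>) \<omega>"
    by (simp add: sum.distrib shared_pairs_def)
  also have "(\<Sum>i\<in>{1..n}. indicator ?L i) = real (lonely_passengers n X t \<omega>)"
    by (simp add: lonely_passengers_def real_time_def indicator_def Int_def)
  finally show ?thesis by simp
qed

text \<open>Sending a lonely passenger to his bus is injective.\<close>

lemma lonely_le_nonempty: "lonely_passengers n X t \<omega> \<le> nonempty_buses n X t \<omega>"
  unfolding lonely_passengers_def nonempty_buses_def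
proof (rule card_inj_on_le)
  show "inj_on (\<lambda>i. real_time X t i \<omega>)
      {i \<in> {1..n}. \<forall>j\<in>{1..n}. j \<noteq> i \<longrightarrow> real_time X t j \<omega> \<noteq> real_time X t i \<omega>}"
    by (rule inj_onI) auto
  show "finite {b. \<exists>i\<in>{1..n}. real_time X t i \<omega> = b}"
    by (rule finite_subset[of _ "(\<lambda>i. real_time X t i \<omega>) ` {1..n}"]) auto
qed auto

lemma nonempty_le: "nonempty_buses n X t \<omega> \<le> n"
proof -
  have "{b. \<exists>i\<in>{1..n}. real_time X t i \<omega> = b} = (\<lambda>i. real_time X t i \<omega>) ` {1..n}" by auto
  then show ?thesis
    unfolding nonempty_buses_def using card_image_le[of "{1..n}" "\<lambda>i. real_time X t i \<omega>"] by simp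
qed

section \<open>Measurability of the two counts\<close>

lemma measurable_nonempty:
  assumes "t \<ge> 1"
  shows "nonempty_buses n X t \<in> measurable M (count_space UNIV)"
proof -
  have "nat \<lfloor>t\<rfloor> \<ge> 1" using assms by linarith
  note [measurable] = random_bus[OF this]
  show ?thesis
    unfolding nonempty_buses_def[abs_def] real_time_def
    by (intro measurable_card) simp
qed

lemma measurable_lonely:
  assumes "t \<ge> 1"
  shows "lonely_passengers n X t \<in> measurable M (count_space UNIV)"
  unfolding lonely_passengers_def[abs_def] real_time_def
proof (intro measurable_card)
  have m: "nat \<lfloor>t\<rfloor> \<ge> 1" using assms by linarith
  fix i
  let ?L = "\<lambda>\<omega>. \<forall>j\<in>{1..n}. j \<noteq> i \<longrightarrow> X (nat \<lfloor>t\<rfloor>) j \<omega> \<noteq> X (nat \<lfloor>t\<rfloor>) i \<omega>"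
  have "{\<omega> \<in> space M. i \<in> {1..n} \<and> ?L \<omega>} \<in> events"
  \<comment> \<open>Here \<open>i\<close> ranges over all naturals, while \<open>random_bus\<close>
    covers only the labels in \<open>{1..n}\<close>; any other label gives the empty event.\<close>
  proof (cases "i \<in> {1..n}")
    case True
    have "Measurable.pred M (\<lambda>\<omega>. X (nat \<lfloor>t\<rfloor>) j \<omega> = X (nat \<lfloor>t\<rfloor>) i \<omega>)" if "j \<in> {1..n}" for j
      using same_bus_events[OF that True m] by (simp add: pred_def)
    then have "Measurable.pred M ?L"
      by (intro pred_intros_finite pred_intros_logic) auto
    then show ?thesis using True by (simp only: pred_def simp_thms)
  next
    case False
    then have "{\<omega> \<in> space M. i \<in> {1..n} \<and> ?L \<omega>} = {}" by blast
    then show ?thesis by (simp only: sets.empty_sets)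
  qed
  then show "{\<omega> \<in> space M. i \<in> {i \<in> {1..n}. \<forall>j\<in>{1..n}. j \<noteq> i \<longrightarrow>
      X (nat \<lfloor>t\<rfloor>) j \<omega> \<noteq> X (nat \<lfloor>t\<rfloor>) i \<omega>}} \<in> events"
    by (simp only: mem_Collect_eq)
qed

section \<open>Markov's inequality and the limits\<close>

text \<open>Stated for any \<open>Y\<close> between the lonely count and \<open>n\<close>, so that
  it serves both limits.\<close>

lemma prob_deviation:
  assumes t: "t \<ge> 1" and \<epsilon>: "\<epsilon> > 0"
    and Y: "\<And>\<omega>. lonely_passengers n X t \<omega> \<le> Y \<omega>" "\<And>\<omega>. Y \<omega> \<le> n"
  shows "prob {\<omega> \<in> space M. \<bar>real (Y \<omega>) / real n - 1\<bar> > \<epsilon>} \<le> 2 / \<epsilon> * (real n / t)"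
proof -
  let ?m = "nat \<lfloor>t\<rfloor>"
  have m: "?m \<ge> 1" using t by linarith
  have "t < real ?m + 1" using t by simp
  \<comment> \<open>The factor 2 in the bound is the price of replacing the integer part of
    \<open>t\<close> by \<open>t\<close> itself: t < m + 1 \<le> 2m.\<close>
  then have tm: "t \<le> 2 * real ?m" using m by simp
  have n: "real n > 0" using passengers by simp
  have [measurable]: "shared_pairs ?m \<in> borel_measurable M"
    using integrable_shared_pairs[OF m] by simp
  have "{\<omega> \<in> space M. \<bar>real (Y \<omega>) / real n - 1\<bar> > \<epsilon>}
      \<subseteq> {\<omega> \<in> space M. shared_pairs ?m \<omega> \<ge> \<epsilon> * real n}"
  proof safe
    fix \<omega> assume \<omega>: "\<omega> \<in> space M" and dev: "\<bar>real (Y \<omega>) / real n - 1\<bar> > \<epsilon>"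
    \<comment> \<open>As \<open>Y\<close> never exceeds \<open>n\<close>, the ratio can deviate only
      downwards.\<close>
    have "real (Y \<omega>) / real n \<le> 1" using Y(2)[of \<omega>] n by simp
    then have "\<epsilon> < 1 - real (Y \<omega>) / real n" using dev by linarith
    then have "\<epsilon> * real n < real n - real (Y \<omega>)"
      using n by (simp add: field_simps)
    also have "\<dots> \<le> shared_pairs ?m \<omega>"
      using lonely_lower_bound[OF \<omega>, of t] Y(1)[of \<omega>] by linarith
    finally show "\<epsilon> * real n \<le> shared_pairs ?m \<omega>" by simp
  qed
  then have "prob {\<omega> \<in> space M. \<bar>real (Y \<omega>) / real n - 1\<bar> > \<epsilon>}
      \<le> prob {\<omega> \<in> space M. shared_pairs ?m \<omega> \<ge> \<epsilon> * real n}"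
    by (intro finite_measure_mono) auto
  also have "\<dots> \<le> expectation (shared_pairs ?m) / (\<epsilon> * real n)"
    using integrable_shared_pairs[OF m] \<epsilon> n
    by (intro integral_Markov_inequality_measure[where A="{}"])
      (auto intro!: shared_pairs_nonneg)
  also have "\<dots> \<le> ((real n)\<^sup>2 / real ?m) / (\<epsilon> * real n)"
    using expectation_shared_pairs[OF m] \<epsilon> n by (intro divide_right_mono) auto
  also have "\<dots> = 1 / \<epsilon> * (real n / real ?m)"
    using n by (simp add: power2_eq_square)
  also have "\<dots> \<le> 1 / \<epsilon> * (2 * real n / t)"
    using m tm t \<epsilon> n by (intro mult_left_mono) (auto simp: field_simps)
  finally show ?thesis by simp
qed

end

theorem theorem5p4:
  fixes M :: "nat \<Rightarrow> 'a measure"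
    and X :: "nat \<Rightarrow> nat \<Rightarrow> nat \<Rightarrow> 'a \<Rightarrow> nat"
    and k :: "nat \<Rightarrow> real"
  assumes "\<And>n. n \<ge> 1 \<Longrightarrow> detachment_process (M n) n (X n)"
    and "\<And>n. n \<ge> 1 \<Longrightarrow> k n \<ge> 1"
    and "(\<lambda>n. real n) \<in> o(k)"
  shows "converges_in_probability M (\<lambda>n \<omega>. real (nonempty_buses n (X n) (k n) \<omega>) / real n) 1
    \<and> converges_in_probability M (\<lambda>n \<omega>. real (lonely_passengers n (X n) (k n) \<omega>) / real n) 1"
proof -
  have lim: "(\<lambda>n. real n / k n) \<longlonglongrightarrow> 0"
    using assms(3) by (rule smalloD_tendsto)
  have conv: "converges_in_probability M (\<lambda>n \<omega>. real (Y n \<omega>) / real n) 1"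
    if meas: "\<And>n. n \<ge> 1 \<Longrightarrow> Y n \<in> measurable (M n) (count_space UNIV)"
      and lower: "\<And>n \<omega>. n \<ge> 1 \<Longrightarrow> lonely_passengers n (X n) (k n) \<omega> \<le> Y n \<omega>"
      and upper: "\<And>n \<omega>. n \<ge> 1 \<Longrightarrow> Y n \<omega> \<le> n" for Y :: "nat \<Rightarrow> 'a \<Rightarrow> nat"
    unfolding converges_in_probability_def
  proof (intro conjI allI impI)
    show "\<forall>\<^sub>F n in sequentially. (\<lambda>\<omega>. real (Y n \<omega>) / real n) \<in> borel_measurable (M n)"
      \<comment> \<open>The processes are given only for \<open>n \<ge> 1\<close>, hence the
        statements for large \<open>n\<close>.\<close>
      using eventually_ge_at_top[of 1]
    proof eventually_elim
      case (elim n)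
      note [measurable] = meas[OF elim]
      show ?case by measurable
    qed
    fix \<epsilon> :: real assume \<epsilon>: "\<epsilon> > 0"
    have bound: "\<forall>\<^sub>F n in sequentially.
        measure (M n) {\<omega> \<in> space (M n). \<bar>real (Y n \<omega>) / real n - 1\<bar> > \<epsilon>} \<le> 2 / \<epsilon> * (real n / k n)"
      using eventually_ge_at_top[of 1]
    proof eventually_elim
      case (elim n)
      show ?case
        by (rule detachment_process.prob_deviation[OF assms(1)[OF elim] assms(2)[OF elim] \<epsilon>
              lower[OF elim] upper[OF elim]])
    qed
    show "(\<lambda>n. measure (M n) {\<omega> \<in> space (M n). \<bar>real (Y n \<omega>) / real n - 1\<bar> > \<epsilon>}) \<longlonglongrightarrow> 0"
      \<comment> \<open>Squeezed between 0 and a constant multiple of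
        \<open>real n / k n\<close>.\<close>
      by (rule tendsto_sandwich[OF _ bound tendsto_const tendsto_mult_right_zero[OF lim]]) simp
  qed
  show ?thesis
  proof
    show "converges_in_probability M (\<lambda>n \<omega>. real (nonempty_buses n (X n) (k n) \<omega>) / real n) 1"
    proof (rule conv)
      fix n :: nat assume n: "n \<ge> 1"
      interpret detachment_process "M n" n "X n" by (rule assms(1)[OF n])
      show "nonempty_buses n (X n) (k n) \<in> measurable (M n) (count_space UNIV)"
        by (rule measurable_nonempty[OF assms(2)[OF n]])
      show "lonely_passengers n (X n) (k n) \<omega> \<le> nonempty_buses n (X n) (k n) \<omega>" for \<omega>
        by (rule lonely_le_nonempty)
      show "nonempty_buses n (X n) (k n) \<omega> \<le> n" for \<omega>
        by (rule nonempty_le)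
    qed
    show "converges_in_probability M (\<lambda>n \<omega>. real (lonely_passengers n (X n) (k n) \<omega>) / real n) 1"
    proof (rule conv)
      fix n :: nat assume n: "n \<ge> 1"
      interpret detachment_process "M n" n "X n" by (rule assms(1)[OF n])
      show "lonely_passengers n (X n) (k n) \<in> measurable (M n) (count_space UNIV)"
        by (rule measurable_lonely[OF assms(2)[OF n]])
      show "lonely_passengers n (X n) (k n) \<omega> \<le> n" for \<omega>
        using lonely_le_nonempty nonempty_le by (rule order_trans)
    qed simp
  qed
qed

end
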